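(* Let $\omega:[0,\infty)\to[0,\infty)$ be a non-decreasing continuous function such that $\omega(t)=0$ implies $t=0$. Let $y:[0,\infty)\to[0,\infty)$ be a continuous function with $$\int_0^\infty \omega(y(t))\,dt<\infty ,$$ and $$y(t)-y(s)\le \int_s^t f(\xi,y(\xi))\,d\xi,\qquad 0\le s\le t,$$ where $f(t,y)$ is a nonnegative continuous function on $[0,\infty)\times[0,\infty)$. Define $$F(t,v):=\int_0^t \max_{0\le\zeta\le v} f(\xi,\zeta)\,d\xi,\qquad v,t\ge 0.$$ If there exists a constant $a>0$ such that the function $t\mapsto F(t,a)$ is uniformly continuous on $[0,\infty)$, then $$\lim_{t\to\infty}y(t)=0.$$ *)

theory Defs
  imports "HOL-Analysis.Analysis"
begin

text \<open>For \<open>f\<close> continuous on the quadrant \<open>[0,\<infinity>) \<times> [0,\<infinity>)\<close> and \<open>v \<ge> 0\<close>, the supremum below is over the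
  continuous image of a nonempty compact interval, so it is attained and is the maximum of
  \<open>f \<xi> \<zeta>\<close> over \<open>0 \<le> \<zeta> \<le> v\<close>.\<close>

definition F_max :: "(real \<Rightarrow> real \<Rightarrow> real) \<Rightarrow> real \<Rightarrow> real \<Rightarrow> real" where
  "F_max f t v = integral {0..t} (\<lambda>\<xi>. SUP \<zeta>\<in>{0..v}. f \<xi> \<zeta>)"

end

theory Submission
  imports Defs
begin

text \<open>
  If \<open>y\<close> does not tend to \<open>0\<close>, then for some level \<open>b \<in> (0, a]\<close> there are arbitrarily late times with
  \<open>y \<ge> b\<close>. The point is that \<open>y\<close> cannot climb from \<open>b/2\<close> to \<open>b\<close> quickly: up to
  the first time at level \<open>b\<close> the values of \<open>y\<close> stay in \<open>[0, b] \<subseteq> [0, a]\<close>, so the integral bounding the growth of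
  \<open>y\<close> is at most an increment of \<open>F_max f _ a\<close>, and uniform continuity supplies a duration \<open>\<delta>\<close>,
  independent of the position on the time axis, over which that increment stays below \<open>b/2\<close>
  (\<open>no_fast_climb\<close>). It does not matter that \<open>y\<close> may be larger than \<open>a\<close> elsewhere.

  Hence each late time \<open>t\<close> with \<open>y t \<ge> b\<close> ends an interval of length \<open>\<delta>\<close> on which \<open>y > b/2\<close>, and
  by monotonicity this interval contributes at least \<open>\<delta> \<omega>(b/2) > 0\<close> to the integral of \<open>\<omega> \<circ> y\<close>. Infinitely
  many disjoint intervals of this kind contradict integrability (\<open>recurrent_mass_not_integrable\<close>).
\<close>

text \<open>Uniform continuity on the compact product makes the functions \<open>f x\<close> and \<open>f x'\<close> uniformly
  close on \<open>K\<close> when \<open>x\<close> and \<open>x'\<close> are close, and uniformly close functions have close suprema.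
  This gives the integrand in \<open>F_max\<close> an actual integral instead of the default value \<open>0\<close>.\<close>

lemma continuous_on_SUP_compact:
  fixes f :: "'a::metric_space \<Rightarrow> 'b::metric_space \<Rightarrow> real"
  assumes S: "compact S" and K: "compact K" "K \<noteq> {}"
    and f: "continuous_on (S \<times> K) (\<lambda>(x, z). f x z)"
  shows "continuous_on S (\<lambda>x. SUP z\<in>K. f x z)"
proof -
  have bdd: "bdd_above (f x ` K)" if "x \<in> S" for x
  proof -
    have "continuous_on K ((\<lambda>(x, z). f x z) \<circ> Pair x)"
      by (intro continuous_on_compose continuous_on_subset[OF f] continuous_intros) (use that in auto)
    then have "continuous_on K (f x)"
      by (simp add: o_def)
    then show ?thesis
      using K(1) by (intro bounded_imp_bdd_above compact_imp_bounded compact_continuous_image)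
  qed
  show ?thesis
    unfolding continuous_on_iff
  proof (intro ballI allI impI)
    fix x and e :: real
    assume x: "x \<in> S" and e: "0 < e"
    have "uniformly_continuous_on (S \<times> K) (\<lambda>(x, z). f x z)"
      using f S K(1) by (intro compact_uniformly_continuous compact_Times)
    then obtain d where d: "0 < d"
      "\<And>p q. p \<in> S \<times> K \<Longrightarrow> q \<in> S \<times> K \<Longrightarrow> dist q p < d \<Longrightarrow>
         dist ((\<lambda>(x, z). f x z) q) ((\<lambda>(x, z). f x z) p) < e / 2"
      unfolding uniformly_continuous_on_def using e half_gt_zero by metis
    have close: "\<bar>f u z - f v z\<bar> < e / 2" if "u \<in> S" "v \<in> S" "dist u v < d" "z \<in> K" for u v z
      using d(2)[of "(v, z)" "(u, z)"] that by (simp add: dist_Pair_Pair dist_real_def)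
    have le: "(SUP z\<in>K. f u z) \<le> (SUP z\<in>K. f v z) + e / 2"
      if uv: "u \<in> S" "v \<in> S" "dist u v < d" for u v
    proof (rule cSUP_least[OF K(2)])
      fix z assume z: "z \<in> K"
      have "f v z \<le> (SUP z\<in>K. f v z)"
        by (rule cSUP_upper[OF z bdd[OF uv(2)]])
      then show "f u z \<le> (SUP z\<in>K. f v z) + e / 2"
        using close[OF uv z] by linarith
    qed
    show "\<exists>d>0. \<forall>x'\<in>S. dist x' x < d \<longrightarrow> dist (SUP z\<in>K. f x' z) (SUP z\<in>K. f x z) < e"
    proof (intro exI[of _ d] conjI d(1) ballI impI)
      fix x' assume x': "x' \<in> S" "dist x' x < d"
      have "dist x x' < d"
        using x'(2) by (simp add: dist_commute)
      then show "dist (SUP z\<in>K. f x' z) (SUP z\<in>K. f x z) < e"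
        using le[OF x'(1) x x'(2)] le[OF x x'(1)] e unfolding dist_real_def by linarith
    qed
  qed
qed

lemma first_hitting_time:
  fixes y :: "real \<Rightarrow> real"
  assumes y: "continuous_on {s..t} y" and "s \<le> t" "y s \<le> b" "b \<le> y t"
  obtains r where "s \<le> r" "r \<le> t" "y r = b" "\<And>\<xi>. s \<le> \<xi> \<Longrightarrow> \<xi> \<le> r \<Longrightarrow> y \<xi> \<le> b"
proof -
  define A where "A = {\<xi> \<in> {s..t}. y \<xi> = b}"
  have "A \<noteq> {}"
    using IVT'[of y s b t] assms by (auto simp: A_def)
  moreover have "compact A"
    unfolding A_def compact_eq_bounded_closed
    using continuous_closed_preimage_constant[OF y, of b]
    by (auto intro: bounded_subset[of "{s..t}"] simp: vimage_def Int_def)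
  ultimately obtain r where r: "r \<in> A" "\<And>\<xi>. \<xi> \<in> A \<Longrightarrow> r \<le> \<xi>"
    using compact_attains_inf[of A] by metis
  show thesis
  proof (rule that[of r])
    show "y \<xi> \<le> b" if \<xi>: "s \<le> \<xi>" "\<xi> \<le> r" for \<xi>
    proof (rule ccontr)
      assume "\<not> y \<xi> \<le> b"
      (* Then y takes the value b before \<xi>, contradicting that r is the first such time. *)
      then obtain x where "s \<le> x" "x \<le> \<xi>" "y x = b"
        using IVT'[of y s b \<xi>] assms(3) \<xi> r(1) continuous_on_subset[OF y, of "{s..\<xi>}"]
        by (auto simp: A_def)
      moreover from this have "r \<le> x"
        using r \<xi> by (auto simp: A_def)
      ultimately have "x = \<xi>"
        using \<xi> by simp
      then show False
        using \<open>y x = b\<close> \<open>\<not> y \<xi> \<le> b\<close> by simp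
    qed
  qed (use r in \<open>auto simp: A_def\<close>)
qed

text \<open>Beyond any given time there is a further interval contributing at least \<open>c\<close>, so the
  partial integrals over \<open>[0, t]\<close> exceed every multiple of \<open>c\<close>, although the integral over the
  half-line bounds them.\<close>

lemma recurrent_mass_not_integrable:
  fixes g :: "real \<Rightarrow> real"
  assumes nonneg: "\<And>t. 0 \<le> t \<Longrightarrow> 0 \<le> g t" and "0 < c"
    and mass: "\<And>T. 0 \<le> T \<Longrightarrow> \<exists>s t. T \<le> s \<and> s \<le> t \<and> c \<le> integral {s..t} g"
  shows "\<not> g integrable_on {0..}"
proof
  assume g: "g integrable_on {0..}"
  have gi: "g integrable_on {s..t}" if "0 \<le> s" for s t
    using that by (intro integrable_on_subinterval[OF g]) auto
  have unbounded: "\<exists>t\<ge>0. real n * c \<le> integral {0..t} g" for n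
  proof (induction n)
    case 0
    show ?case
      by (intro exI[of _ 0]) simp
  next
    case (Suc n)
    then obtain T where T: "0 \<le> T" "real n * c \<le> integral {0..T} g"
      by blast
    obtain s t where st: "T \<le> s" "s \<le> t" "c \<le> integral {s..t} g"
      using mass[OF T(1)] by blast
    have "integral {0..T} g \<le> integral {0..s} g"
      using T st by (intro integral_subset_le gi) (auto intro: nonneg)
    moreover have "integral {0..s} g + integral {s..t} g = integral {0..t} g"
      using T st by (intro Henstock_Kurzweil_Integration.integral_combine gi) auto
    ultimately show ?case
      using T st by (intro exI[of _ t]) (auto simp: algebra_simps)
  qed
  obtain n where "integral {0..} g < real n * c"
    using reals_Archimedean3[OF \<open>0 < c\<close>] by blast
  moreover obtain t where "0 \<le> t" "real n * c \<le> integral {0..t} g"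
    using unbounded by blast
  moreover have "integral {0..t} g \<le> integral {0..} g"
    by (intro integral_subset_le gi g) (auto intro: nonneg)
  ultimately show False
    by linarith
qed

text \<open>While \<open>y\<close> stays in \<open>[0, v]\<close>, the integrand lies below the maximum integrated in \<open>F_max\<close>.
  Additivity over adjacent intervals turns the integral of that maximum over \<open>[s, t]\<close> into an
  increment of \<open>F_max\<close>; this step needs the maximum to be integrable, hence its continuity in time.\<close>

lemma increment_le_F_max:
  fixes y :: "real \<Rightarrow> real" and f :: "real \<Rightarrow> real \<Rightarrow> real"
  assumes f: "continuous_on ({0..} \<times> {0..}) (\<lambda>(t, u). f t u)"
    and y: "continuous_on {0..} y" "\<And>t. 0 \<le> t \<Longrightarrow> 0 \<le> y t"
    and st: "0 \<le> s" "s \<le> t" and v: "\<And>\<xi>. s \<le> \<xi> \<Longrightarrow> \<xi> \<le> t \<Longrightarrow> y \<xi> \<le> v"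
  shows "integral {s..t} (\<lambda>\<xi>. f \<xi> (y \<xi>)) \<le> F_max f t v - F_max f s v"
proof -
  define M where "M \<xi> = (SUP \<zeta>\<in>{0..v}. f \<xi> \<zeta>)" for \<xi>
  have "0 \<le> v"
    using y(2)[of s] v[of s] st by auto
  have "continuous_on {0..t} M"
    unfolding M_def using \<open>0 \<le> v\<close>
    by (intro continuous_on_SUP_compact continuous_on_subset[OF f]) auto
  then have M: "M integrable_on {0..t}"
    by (rule integrable_continuous_real)
  have "integral {s..t} (\<lambda>\<xi>. f \<xi> (y \<xi>)) \<le> integral {s..t} M"
  proof (rule integral_le)
    have "continuous_on {s..t} (\<lambda>\<xi>. (\<xi>, y \<xi>))"
      using continuous_on_subset[OF y(1), of "{s..t}"] st by (intro continuous_intros) auto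
    moreover have "(\<lambda>\<xi>. (\<xi>, y \<xi>)) ` {s..t} \<subseteq> {0..} \<times> {0..}"
      using st(1) by (auto intro: y(2))
    ultimately have "continuous_on {s..t} (\<lambda>\<xi>. (\<lambda>(t, u). f t u) (\<xi>, y \<xi>))"
      by (rule continuous_on_compose2[OF f])
    then show "(\<lambda>\<xi>. f \<xi> (y \<xi>)) integrable_on {s..t}"
      by (intro integrable_continuous_real) simp
    show "M integrable_on {s..t}"
      using st by (intro integrable_on_subinterval[OF M]) auto
    fix \<xi> assume \<xi>: "\<xi> \<in> {s..t}"
    have "continuous_on {0..v} ((\<lambda>(t, u). f t u) \<circ> Pair \<xi>)"
      using \<xi> st by (intro continuous_on_compose continuous_on_subset[OF f] continuous_intros) auto
    then have "bdd_above (f \<xi> ` {0..v})"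
      by (intro bounded_imp_bdd_above compact_imp_bounded compact_continuous_image)
        (auto simp: o_def)
    then show "f \<xi> (y \<xi>) \<le> M \<xi>"
      unfolding M_def using \<xi> st v[of \<xi>] y(2)[of \<xi>] by (intro cSUP_upper) auto
  qed
  also have "integral {0..s} M + integral {s..t} M = integral {0..t} M"
    using st by (intro Henstock_Kurzweil_Integration.integral_combine M)
  then have "integral {s..t} M = F_max f t v - F_max f s v"
    unfolding F_max_def M_def by linarith
  finally show ?thesis .
qed

text \<open>Only the part of the trajectory up to the first time at level \<open>b\<close> is used, because there
  \<open>y\<close> is bounded by \<open>a\<close> and \<open>F_max f _ a\<close> bounds its growth.\<close>

lemma no_fast_climb:
  fixes y :: "real \<Rightarrow> real" and f :: "real \<Rightarrow> real \<Rightarrow> real"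
  assumes f: "continuous_on ({0..} \<times> {0..}) (\<lambda>(t, u). f t u)"
    and y: "continuous_on {0..} y" "\<And>t. 0 \<le> t \<Longrightarrow> 0 \<le> y t"
    and growth: "\<And>s t. 0 \<le> s \<Longrightarrow> s \<le> t \<Longrightarrow> y t - y s \<le> integral {s..t} (\<lambda>\<xi>. f \<xi> (y \<xi>))"
    and F: "\<And>s t. 0 \<le> s \<Longrightarrow> s \<le> t \<Longrightarrow> t - s \<le> \<delta> \<Longrightarrow> F_max f t a - F_max f s a < b - c"
    and "b \<le> a" "c \<le> b" and st: "0 \<le> s" "s \<le> t" "t - s \<le> \<delta>" and "b \<le> y t"
  shows "c < y s"
proof (rule ccontr)
  assume "\<not> c < y s"
  then have "y s \<le> b"
    using \<open>c \<le> b\<close> by simp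
  have "continuous_on {s..t} y"
    using st by (intro continuous_on_subset[OF y(1)]) auto
  then obtain r where r: "s \<le> r" "r \<le> t" "y r = b" "\<And>\<xi>. s \<le> \<xi> \<Longrightarrow> \<xi> \<le> r \<Longrightarrow> y \<xi> \<le> b"
    using first_hitting_time[OF _ st(2) \<open>y s \<le> b\<close> \<open>b \<le> y t\<close>] by metis
  have "b - c \<le> y r - y s"
    using r(3) \<open>\<not> c < y s\<close> by simp
  also have "\<dots> \<le> integral {s..r} (\<lambda>\<xi>. f \<xi> (y \<xi>))"
    using growth st r(1) by blast
  also have "\<dots> \<le> F_max f r a - F_max f s a"
    using r(4) \<open>b \<le> a\<close> by (intro increment_le_F_max[OF f y st(1) r(1)]) (auto intro: order_trans)
  also have "\<dots> < b - c"
    using F[of s r] st r by simp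
  finally show False
    by simp
qed

theorem theorem2p1:
  fixes \<omega> y :: "real \<Rightarrow> real" and f :: "real \<Rightarrow> real \<Rightarrow> real"
  assumes omega_nonneg: "\<And>t. 0 \<le> t \<Longrightarrow> 0 \<le> \<omega> t"
    and omega_mono: "mono_on {0..} \<omega>"
    and omega_cont: "continuous_on {0..} \<omega>"
    and omega_zero: "\<And>t. 0 \<le> t \<Longrightarrow> \<omega> t = 0 \<Longrightarrow> t = 0"
    and y_nonneg: "\<And>t. 0 \<le> t \<Longrightarrow> 0 \<le> y t"
    and y_cont: "continuous_on {0..} y"
    and omega_y_integrable: "(\<lambda>t. \<omega> (y t)) integrable_on {0..}"
    and f_nonneg: "\<And>t u. 0 \<le> t \<Longrightarrow> 0 \<le> u \<Longrightarrow> 0 \<le> f t u"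
    and f_cont: "continuous_on ({0..} \<times> {0..}) (\<lambda>(t, u). f t u)"
    and y_ineq: "\<And>s t. 0 \<le> s \<Longrightarrow> s \<le> t \<Longrightarrow> y t - y s \<le> integral {s..t} (\<lambda>\<xi>. f \<xi> (y \<xi>))"
    and F_unif_cont: "\<exists>a>0. uniformly_continuous_on {0..} (\<lambda>t. F_max f t a)"
  shows "(y \<longlongrightarrow> 0) at_top"
proof (rule ccontr)
  assume "\<not> (y \<longlongrightarrow> 0) at_top"
  then obtain e where e: "0 < e" and "\<not> (\<forall>\<^sub>F t in at_top. dist (y t) 0 < e)"
    unfolding tendsto_iff by blast
  then have late: "\<exists>t\<ge>T. e \<le> \<bar>y t\<bar>" for T
    unfolding eventually_at_top_linorder by (auto simp: not_less)
  obtain a where a: "0 < a" and uc: "uniformly_continuous_on {0..} (\<lambda>t. F_max f t a)"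
    using F_unif_cont by blast
  define b where "b = min e a"
  have b: "0 < b" "b \<le> a" "b \<le> e"
    using e a by (auto simp: b_def)
  obtain d where d: "0 < d"
    "\<And>s t. s \<in> {0..} \<Longrightarrow> t \<in> {0..} \<Longrightarrow> dist t s < d \<Longrightarrow>
       dist (F_max f t a) (F_max f s a) < b / 2"
    using uc b(1) unfolding uniformly_continuous_on_def by (metis half_gt_zero)
  (* Halving d turns the strict bound on distances into one valid on closed intervals. *)
  define \<delta> where "\<delta> = d / 2"
  have \<delta>: "0 < \<delta>" "\<delta> < d"
    using d(1) by (auto simp: \<delta>_def)
  have F: "F_max f t a - F_max f s a < b - b / 2" if "0 \<le> s" "s \<le> t" "t - s \<le> \<delta>" for s t
  proof -
    have "dist (F_max f t a) (F_max f s a) < b / 2"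
      using that \<delta> by (intro d(2)) (auto simp: dist_real_def)
    then show ?thesis
      unfolding dist_real_def by linarith
  qed
  have "\<not> (\<lambda>t. \<omega> (y t)) integrable_on {0..}"
  proof (rule recurrent_mass_not_integrable)
    show "0 \<le> \<omega> (y t)" if "0 \<le> t" for t
      using that omega_nonneg y_nonneg by blast
    have "\<omega> (b / 2) \<noteq> 0"
      using omega_zero[of "b / 2"] b(1) by auto
    then show "0 < \<delta> * \<omega> (b / 2)"
      using omega_nonneg[of "b / 2"] b(1) \<delta>(1) by simp
    fix T :: real
    assume T: "0 \<le> T"
    obtain t where t: "T + \<delta> \<le> t" "e \<le> \<bar>y t\<bar>"
      using late by blast
    have yt: "b \<le> y t"
      using y_nonneg[of t] t T \<delta>(1) b(3) by auto
    have "integral {t - \<delta>..t} (\<lambda>_. \<omega> (b / 2)) \<le> integral {t - \<delta>..t} (\<lambda>\<xi>. \<omega> (y \<xi>))"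
    proof (rule integral_le)
      show "(\<lambda>\<xi>. \<omega> (y \<xi>)) integrable_on {t - \<delta>..t}"
        using t T by (intro integrable_on_subinterval[OF omega_y_integrable]) auto
      fix \<xi> assume \<xi>: "\<xi> \<in> {t - \<delta>..t}"
      then have "b / 2 < y \<xi>"
        using t T b yt
        by (intro no_fast_climb[OF f_cont y_cont y_nonneg y_ineq F, where t = t]) auto
      then show "\<omega> (b / 2) \<le> \<omega> (y \<xi>)"
        using b(1) by (intro mono_onD[OF omega_mono]) auto
    qed (rule integrable_const_ivl)
    then have "\<delta> * \<omega> (b / 2) \<le> integral {t - \<delta>..t} (\<lambda>\<xi>. \<omega> (y \<xi>))"
      using \<delta>(1) by simp
    then show "\<exists>s t. T \<le> s \<and> s \<le> t \<and> \<delta> * \<omega> (b / 2) \<le> integral {s..t} (\<lambda>\<xi>. \<omega> (y \<xi>))"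
      using t \<delta>(1) by (intro exI[of _ "t - \<delta>"] exI[of _ t]) auto
  qed
  then show False
    using omega_y_integrable by contradiction
qed

end
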